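(* Fix $R\in(0,1)$ and $\eta>0$, and let $T$ be the two-particle velocity evolution map on $\mathbb{S}^1\times\mathbb{S}^1$ defined in the context. For every sufficiently small $\varepsilon>0$ there exist a positive integer $N_\varepsilon$, a nonempty open set $W$ in the space of parameters, i.e. of integrals of motion $(N,E,v_n,u_n)$, and a set of initial conditions $A\subset\mathbb{S}^1\times\mathbb{S}^1$ of Lebesgue measure bigger than $\varepsilon$, with the following property. Given a system with parameters from $W$, for any $(s_0,t_0)\in A$ the iterate $(s_k,t_k)=T^k(s_0,t_0)$ is in the odd part of the phase space, and thus $s_k=s_0+k\gamma$ (mod $1$), as long as $0\le k<N_\varepsilon$. Moreover, the $N_\varepsilon$ can be taken so that $N_\varepsilon\to\infty$ as $\varepsilon\to0$.
   Context: Two point particles of equal mass move in the annulus between concentric circles of radii $R<1$ and $1$. The outer circle is an ordinary elastic billiard wall; the inner circle rotates with angular velocity $\omega$. Both particles alternate between inner and outer collisions. Let $v,u$ be the tangential components at the inner circle of the velocities of the first and second particle, and $v_n,u_n>0$ the (absolute values of the) normal components at the inner circle, which are integrals of motion. Put $q=\sqrt{\eta}R\omega$. A collision of the first (second) particle with the inner circle is called a v-collision (u-collision). There are two further integrals $$v^2+u^2+q^2=E,\qquad v+u+\sqrt{\eta}\,q=N,$$ which define the velocity circle in the $(v,u,q)$-space $\mathbb{R}^3$ (assumed nondegenerate, i.e. $N^2<E(2+\eta)$). A v-collision acts as the orthogonal reflection across the plane $\sqrt{\eta}\,v-q=0$, a u-collision as the orthogonal reflection across the plane $\sqrt{\eta}\,u-q=0$.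 On the plane of the velocity circle these are reflections across lines with angle $\gamma/2\in(0,\pi/2)$, $\cos\frac{\gamma}{2}=\frac{1}{1+\eta}$. The velocity circle is parametrized by normalized arclength $s\in\mathbb{S}^1=\mathbb{R}/\mathbb{Z}$ with $s=0$ at one of the points where it meets the plane $\sqrt{\eta}\,v-q=0$, oriented so that (with $\gamma$ also measured in full turns, i.e. replaced by $\gamma/(2\pi)$) v-collisions are $s\mapsto-s$ and u-collisions are $s\mapsto s_2=-s-\gamma$ (mod $1$). Write $v(s),u(s)$ for the coordinates at $s$. For tangential component $a$ and normal component $b>0$ at the inner circle, the time between consecutive inner collisions of a particle is $$\tau(a,b)=\frac{2\,d}{\sqrt{a^2+b^2}},\qquad d=\sqrt{1-R^2\sin^2\psi}-R\cos\psi,\quad \psi=\arctan(a/b)$$ ($d$ is the length of the free flight between the two circles). Put $$\tau_1(s)=\tau(v(s),v_n),\quad \tau_2(s)=\tau(u(s),u_n),\quad \tau_3(s)=\tau(u(s_2),u_n),$$ $$\hat\lambda(s)=\frac{\tau_2(s)}{\tau_2(s)+\tau_3(s)}\in[0,1),\qquad \hat t(s)=\left\{\frac{\tau_1(s)}{\tau_2(s)+\tau_3(s)}\right\}\in[0,1),$$ where $\{\cdot\}$ is the fractional part. The system is observed at v-collisions; $s$ is the velocity state just after the v-collision, and $t\in[0,1)$ is such that the last u-collision preceded the v-collision by time $t\,\tau_2(s)$. The quantities $t,\hat t$ are regarded as elements of $\mathbb{S}^1$ identified with $[0,1)$, sums being understood mod $1$. The evolution $T:(s,t)\mapsto(s',t')$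 is $$(s',t')=\left(-s,\ t+\frac{\hat t}{\hat\lambda}\right)\ \text{ if } t\hat\lambda+\hat t<\hat\lambda\ \text{ (even case)},\qquad (s',t')=\left(s+\gamma,\ \frac{\tau_2}{\tau_3}t+\frac{\hat t}{1-\hat\lambda}\right)\ \text{ if } t\hat\lambda+\hat t>\hat\lambda\ \text{ (odd case)},$$ where $\hat\lambda,\hat t,\tau_2,\tau_3$ are evaluated at $s$ and the entries are taken mod $1$. The odd part of the phase space is the set of $(s,t)$ for which the odd case holds. *)

theory Defs
  imports "HOL-Analysis.Analysis"
begin

section \<open>The velocity circle\<close>

text \<open>
  Points of velocity space are triples (v, u, q).  A tuple (N, E, vn, un) lists the integrals
  of motion.  Parameters and functions on the circle \<open>\<real>/\<int>\<close> are written on the reals;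
  the circle itself is identified with \<open>{0..<1}\<close> via \<^const>\<open>frac\<close>.
\<close>

type_synonym velocity = "real \<times> real \<times> real"
type_synonym integrals = "real \<times> real \<times> real \<times> real"

definition parameters :: "real \<Rightarrow> integrals set" where
  "parameters \<eta> = {(N, E, vn, un). N\<^sup>2 < E * (2 + \<eta>) \<and> 0 < vn \<and> 0 < un}"

definition velocity_circle :: "real \<Rightarrow> real \<Rightarrow> real \<Rightarrow> velocity set" where
  "velocity_circle \<eta> N E =
     {(v, u, q). v\<^sup>2 + u\<^sup>2 + q\<^sup>2 = E \<and> v + u + sqrt \<eta> * q = N}"

definition reflection :: "'a::real_inner \<Rightarrow> 'a \<Rightarrow> 'a" where
  "reflection n x = x - (2 * (x \<bullet> n) / (n \<bullet> n)) *\<^sub>R n"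

definition v_collision :: "real \<Rightarrow> velocity \<Rightarrow> velocity" where
  "v_collision \<eta> = reflection (sqrt \<eta>, 0, -1)"

definition u_collision :: "real \<Rightarrow> velocity \<Rightarrow> velocity" where
  "u_collision \<eta> = reflection (0, sqrt \<eta>, -1)"

text \<open>
  The lines fixed by the two reflections form an angle with cosine \<open>1 / (1 + \<eta>)\<close>;
  \<open>\<gamma>\<close> is twice that angle, in full turns.
\<close>

definition gam :: "real \<Rightarrow> real" where
  "gam \<eta> = 2 * arccos (1 / (1 + \<eta>)) / (2 * pi)"

definition center :: "real \<Rightarrow> real \<Rightarrow> velocity" where
  "center \<eta> N = (N / (2 + \<eta>)) *\<^sub>R (1, 1, sqrt \<eta>)"

definition radius :: "real \<Rightarrow> real \<Rightarrow> real \<Rightarrow> real" where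
  "radius \<eta> N E = sqrt (E - N\<^sup>2 / (2 + \<eta>))"

text \<open>
  An orthonormal frame of the plane of the circle: the first vector lies in the plane
  \<open>sqrt \<eta> * v = q\<close>, the second one is normal to it.  The sign of the second vector
  is the one for which u-collisions become \<open>s \<mapsto> -s - \<gamma>\<close> rather than \<open>s \<mapsto> -s + \<gamma>\<close>.
\<close>

definition frame1 :: "real \<Rightarrow> velocity" where
  "frame1 \<eta> = (1 / sqrt ((1 + \<eta>) * (2 + \<eta>))) *\<^sub>R (1, - (1 + \<eta>), sqrt \<eta>)"

definition frame2 :: "real \<Rightarrow> velocity" where
  "frame2 \<eta> = (1 / sqrt (1 + \<eta>)) *\<^sub>R (- sqrt \<eta>, 0, 1)"

text \<open>
  Normalized arclength parametrization.  The sign \<open>\<sigma> \<in> {-1, 1}\<close> selects which of the two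
  points of the circle in the plane \<open>sqrt \<eta> * v = q\<close> is \<open>s = 0\<close>.
\<close>

definition circle_point :: "real \<Rightarrow> real \<Rightarrow> real \<Rightarrow> real \<Rightarrow> real \<Rightarrow> velocity" where
  "circle_point \<eta> \<sigma> N E s =
     center \<eta> N + (\<sigma> * radius \<eta> N E) *\<^sub>R
       (cos (2 * pi * s) *\<^sub>R frame1 \<eta> + sin (2 * pi * s) *\<^sub>R frame2 \<eta>)"


section \<open>The evolution map\<close>

text \<open>Time between inner collisions, for tangential component \<open>a\<close> and normal component \<open>b > 0\<close>.\<close>

definition flight_length :: "real \<Rightarrow> real \<Rightarrow> real" where
  "flight_length R \<psi> = sqrt (1 - R\<^sup>2 * (sin \<psi>)\<^sup>2) - R * cos \<psi>"

definition tau :: "real \<Rightarrow> real \<Rightarrow> real \<Rightarrow> real" where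
  "tau R a b = 2 * flight_length R (arctan (a / b)) / sqrt (a\<^sup>2 + b\<^sup>2)"

fun v_at :: "real \<Rightarrow> real \<Rightarrow> integrals \<Rightarrow> real \<Rightarrow> real" where
  "v_at \<eta> \<sigma> (N, E, vn, un) s = fst (circle_point \<eta> \<sigma> N E s)"

fun u_at :: "real \<Rightarrow> real \<Rightarrow> integrals \<Rightarrow> real \<Rightarrow> real" where
  "u_at \<eta> \<sigma> (N, E, vn, un) s = fst (snd (circle_point \<eta> \<sigma> N E s))"

fun tau1 :: "real \<Rightarrow> real \<Rightarrow> real \<Rightarrow> integrals \<Rightarrow> real \<Rightarrow> real" where
  "tau1 R \<eta> \<sigma> (N, E, vn, un) s = tau R (v_at \<eta> \<sigma> (N, E, vn, un) s) vn"

fun tau2 :: "real \<Rightarrow> real \<Rightarrow> real \<Rightarrow> integrals \<Rightarrow> real \<Rightarrow> real" where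
  "tau2 R \<eta> \<sigma> (N, E, vn, un) s = tau R (u_at \<eta> \<sigma> (N, E, vn, un) s) un"

fun tau3 :: "real \<Rightarrow> real \<Rightarrow> real \<Rightarrow> integrals \<Rightarrow> real \<Rightarrow> real" where
  "tau3 R \<eta> \<sigma> (N, E, vn, un) s = tau R (u_at \<eta> \<sigma> (N, E, vn, un) (- s - gam \<eta>)) un"

definition lam_hat :: "real \<Rightarrow> real \<Rightarrow> real \<Rightarrow> integrals \<Rightarrow> real \<Rightarrow> real" where
  "lam_hat R \<eta> \<sigma> p s = tau2 R \<eta> \<sigma> p s / (tau2 R \<eta> \<sigma> p s + tau3 R \<eta> \<sigma> p s)"

definition t_hat :: "real \<Rightarrow> real \<Rightarrow> real \<Rightarrow> integrals \<Rightarrow> real \<Rightarrow> real" where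
  "t_hat R \<eta> \<sigma> p s = frac (tau1 R \<eta> \<sigma> p s / (tau2 R \<eta> \<sigma> p s + tau3 R \<eta> \<sigma> p s))"

definition phase_space :: "(real \<times> real) set" where
  "phase_space = {0..<1} \<times> {0..<1}"

text \<open>The sums \<open>t * lam_hat + t_hat\<close> deciding between the two cases are sums mod 1.\<close>

definition even_part :: "real \<Rightarrow> real \<Rightarrow> real \<Rightarrow> integrals \<Rightarrow> (real \<times> real) set" where
  "even_part R \<eta> \<sigma> p =
     {(s, t) \<in> phase_space. frac (t * lam_hat R \<eta> \<sigma> p s + t_hat R \<eta> \<sigma> p s) < lam_hat R \<eta> \<sigma> p s}"

definition odd_part :: "real \<Rightarrow> real \<Rightarrow> real \<Rightarrow> integrals \<Rightarrow> (real \<times> real) set" where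
  "odd_part R \<eta> \<sigma> p =
     {(s, t) \<in> phase_space. frac (t * lam_hat R \<eta> \<sigma> p s + t_hat R \<eta> \<sigma> p s) > lam_hat R \<eta> \<sigma> p s}"

text \<open>
  The map is not defined where neither case holds (simultaneous collisions of the
  two particles with the inner circle).
\<close>

definition evolution ::
    "real \<Rightarrow> real \<Rightarrow> real \<Rightarrow> integrals \<Rightarrow> real \<times> real \<Rightarrow> real \<times> real" where
  "evolution R \<eta> \<sigma> p = (\<lambda>(s, t).
     if (s, t) \<in> even_part R \<eta> \<sigma> p then
       (frac (- s), frac (t + t_hat R \<eta> \<sigma> p s / lam_hat R \<eta> \<sigma> p s))
     else if (s, t) \<in> odd_part R \<eta> \<sigma> p then
       (frac (s + gam \<eta>),
        frac (tau2 R \<eta> \<sigma> p s / tau3 R \<eta> \<sigma> p s * t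
              + t_hat R \<eta> \<sigma> p s / (1 - lam_hat R \<eta> \<sigma> p s)))
     else undefined)"


section \<open>The parametrization has the required properties\<close>

lemma sqrt_abbrevs:
  assumes "0 < \<eta>"
  obtains S P Q :: real where "S = sqrt \<eta>" "P = sqrt (1 + \<eta>)" "Q = sqrt (2 + \<eta>)"
    "0 < S" "0 < P" "0 < Q" "\<eta> = S\<^sup>2" "P\<^sup>2 = 1 + S\<^sup>2" "Q\<^sup>2 = 2 + S\<^sup>2"
    "frame1 \<eta> = (1 / (P * Q), - P / Q, S / (P * Q))" "frame2 \<eta> = (- S / P, 0, 1 / P)"
proof -
  define S P Q where d: "S = sqrt \<eta>" "P = sqrt (1 + \<eta>)" "Q = sqrt (2 + \<eta>)"
  have pos: "0 < S" "0 < P" "0 < Q" using assms by (auto simp: d)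
  have sq: "\<eta> = S\<^sup>2" "P\<^sup>2 = 1 + S\<^sup>2" "Q\<^sup>2 = 2 + S\<^sup>2" using assms by (auto simp: d)
  have PQ: "sqrt ((1 + \<eta>) * (2 + \<eta>)) = P * Q" by (simp add: d real_sqrt_mult)
  have PP: "1 + \<eta> = P * P" using assms by (simp add: d)
  have "frame1 \<eta> = (1 / (P * Q), - P / Q, S / (P * Q))"
    unfolding frame1_def PQ using pos by (simp add: PP d(1)[symmetric])
  moreover have "frame2 \<eta> = (- S / P, 0, 1 / P)"
    by (simp add: frame2_def d)
  ultimately show ?thesis by (intro that[OF d pos sq])
qed

lemma frame_orthonormal:
  assumes "0 < \<eta>"
  shows "frame1 \<eta> \<bullet> frame1 \<eta> = 1" "frame2 \<eta> \<bullet> frame2 \<eta> = 1" "frame1 \<eta> \<bullet> frame2 \<eta> = 0"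
    "frame1 \<eta> \<bullet> (1, 1, sqrt \<eta>) = 0" "frame2 \<eta> \<bullet> (1, 1, sqrt \<eta>) = 0"
proof -
  obtain S P Q where d: "S = sqrt \<eta>" "P = sqrt (1 + \<eta>)" "Q = sqrt (2 + \<eta>)"
    "0 < S" "0 < P" "0 < Q" "\<eta> = S\<^sup>2" "P\<^sup>2 = 1 + S\<^sup>2" "Q\<^sup>2 = 2 + S\<^sup>2"
    "frame1 \<eta> = (1 / (P * Q), - P / Q, S / (P * Q))" "frame2 \<eta> = (- S / P, 0, 1 / P)"
    by (rule sqrt_abbrevs[OF assms])
  have PQ: "P * P = 1 + S * S" "Q * Q = 2 + S * S" using d(8,9) by (auto simp: power2_eq_square)
  have e: "frame1 \<eta> \<bullet> frame1 \<eta> = (1 + (P * P) * (P * P) + S * S) / ((P * P) * (Q * Q))"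
    "frame2 \<eta> \<bullet> frame2 \<eta> = (S * S + 1) / (P * P)"
    "frame1 \<eta> \<bullet> (1, 1, S) = (1 - P * P + S * S) / (P * Q)"
    unfolding d(10,11) using d(5,6) by (simp_all add: field_simps)
  have nz: "1 + S * S \<noteq> 0" "2 + S * S \<noteq> 0" by (smt (verit) zero_le_square)+
  show "frame1 \<eta> \<bullet> frame1 \<eta> = 1"
    unfolding e PQ using nz by (simp add: divide_simps) (simp add: algebra_simps)
  show "frame2 \<eta> \<bullet> frame2 \<eta> = 1"
    unfolding e PQ using nz by simp
  show "frame1 \<eta> \<bullet> (1, 1, sqrt \<eta>) = 0"
    unfolding d(1)[symmetric] e PQ by simp
  show "frame2 \<eta> \<bullet> (1, 1, sqrt \<eta>) = 0"
    unfolding d(1)[symmetric] d(11) inner_Pair inner_real_def by simp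
  show "frame1 \<eta> \<bullet> frame2 \<eta> = 0"
    unfolding d(10,11) inner_Pair inner_real_def by simp
qed

lemma center_orthogonal:
  assumes "0 < \<eta>"
  shows "center \<eta> N \<bullet> frame1 \<eta> = 0" "center \<eta> N \<bullet> frame2 \<eta> = 0"
  using frame_orthonormal(4,5)[OF assms]
  unfolding center_def inner_scaleR_left inner_commute[of "(1, 1, sqrt \<eta>)"]
  by (simp_all only: mult_zero_right)

lemma frame_products:
  assumes "0 < \<eta>"
  shows "frame1 \<eta> \<bullet> frame1 \<eta> = 1" "frame2 \<eta> \<bullet> frame2 \<eta> = 1"
    "frame1 \<eta> \<bullet> frame2 \<eta> = 0" "frame2 \<eta> \<bullet> frame1 \<eta> = 0"
    "center \<eta> N \<bullet> frame1 \<eta> = 0" "center \<eta> N \<bullet> frame2 \<eta> = 0"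
    "frame1 \<eta> \<bullet> center \<eta> N = 0" "frame2 \<eta> \<bullet> center \<eta> N = 0"
  using frame_orthonormal[OF assms] center_orthogonal[OF assms]
  by (simp_all only: inner_commute[of "frame2 \<eta>" "frame1 \<eta>"]
      inner_commute[of "frame1 \<eta>" "center \<eta> N"] inner_commute[of "frame2 \<eta>" "center \<eta> N"])

lemma radius_pos:
  assumes "0 < \<eta>" "N\<^sup>2 < E * (2 + \<eta>)"
  shows "0 < radius \<eta> N E"
  using assms by (simp add: radius_def field_simps)

lemma circle_point_periodic: "circle_point \<eta> \<sigma> N E (s + 1) = circle_point \<eta> \<sigma> N E s"
proof -
  have "2 * pi * (s + 1) = 2 * pi * s + 2 * pi" by (simp add: algebra_simps)
  then show ?thesis unfolding circle_point_def by (simp only: sin_periodic cos_periodic)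
qed

lemma circle_point_zero:
  assumes "0 < \<eta>"
  shows "sqrt \<eta> * fst (circle_point \<eta> \<sigma> N E 0) - snd (snd (circle_point \<eta> \<sigma> N E 0)) = 0"
  by (simp add: circle_point_def center_def frame1_def algebra_simps)

lemma reflection_frame:
  fixes w x r k :: real
  assumes "0 < \<eta>" "k \<noteq> 0"
  defines "m \<equiv> k *\<^sub>R (sin w *\<^sub>R frame1 \<eta> + cos w *\<^sub>R frame2 \<eta>)"
  shows "reflection m (center \<eta> N + r *\<^sub>R (cos x *\<^sub>R frame1 \<eta> + sin x *\<^sub>R frame2 \<eta>))
       = center \<eta> N + r *\<^sub>R (cos (- x - 2 * w) *\<^sub>R frame1 \<eta> + sin (- x - 2 * w) *\<^sub>R frame2 \<eta>)"
proof -
  define p where "p = center \<eta> N + r *\<^sub>R (cos x *\<^sub>R frame1 \<eta> + sin x *\<^sub>R frame2 \<eta>)"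
  note o = frame_products[OF assms(1)]
  have "(k *\<^sub>R (a *\<^sub>R frame1 \<eta> + b *\<^sub>R frame2 \<eta>)) \<bullet> (k *\<^sub>R (a *\<^sub>R frame1 \<eta> + b *\<^sub>R frame2 \<eta>))
      = k\<^sup>2 * (a\<^sup>2 + b\<^sup>2)" for a b
    using o by (simp add: inner_add_left inner_add_right power2_eq_square algebra_simps)
  then have mm: "m \<bullet> m = k\<^sup>2" by (simp add: m_def)
  have pm: "p \<bullet> m = k * (r * sin (x + w))"
    using o by (simp add: p_def m_def inner_add_left inner_add_right sin_add algebra_simps)
  have sm: "c *\<^sub>R m = (c * k) *\<^sub>R (sin w *\<^sub>R frame1 \<eta> + cos w *\<^sub>R frame2 \<eta>)" for c
    by (simp add: m_def)
  have "2 * (p \<bullet> m) / (m \<bullet> m) * k = 2 * r * sin (x + w)"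
    using assms(2) by (simp add: mm pm power2_eq_square)
  then have "reflection m p
      = p - (2 * r * sin (x + w)) *\<^sub>R (sin w *\<^sub>R frame1 \<eta> + cos w *\<^sub>R frame2 \<eta>)"
    by (simp only: reflection_def sm)
  also have "\<dots> = center \<eta> N + r *\<^sub>R ((cos x - 2 * sin (x + w) * sin w) *\<^sub>R frame1 \<eta>
                   + (sin x - 2 * sin (x + w) * cos w) *\<^sub>R frame2 \<eta>)"
    by (simp add: p_def algebra_simps)
  also have "cos x - 2 * sin (x + w) * sin w = cos (- x - 2 * w)"
    using cos_diff[of "x + w" w] cos_add[of "x + w" w] cos_minus[of "x + 2 * w"]
    by (simp add: algebra_simps)
  also have "sin x - 2 * sin (x + w) * cos w = sin (- x - 2 * w)"
    using sin_diff[of "x + w" w] sin_add[of "x + w" w] sin_minus[of "x + 2 * w"]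
    by (simp add: algebra_simps)
  finally show ?thesis by (simp add: p_def)
qed

lemma v_collision_circle_point:
  assumes "0 < \<eta>"
  shows "v_collision \<eta> (circle_point \<eta> \<sigma> N E s) = circle_point \<eta> \<sigma> N E (- s)"
proof -
  have "(sqrt \<eta>, 0, -1) = (- sqrt (1 + \<eta>)) *\<^sub>R (sin 0 *\<^sub>R frame1 \<eta> + cos 0 *\<^sub>R frame2 \<eta>)"
    using assms by (simp add: frame2_def)
  then show ?thesis
    unfolding v_collision_def circle_point_def
    using reflection_frame[OF assms, of "- sqrt (1 + \<eta>)" 0 N "\<sigma> * radius \<eta> N E" "2 * pi * s"] assms
    by simp
qed

lemma u_collision_circle_point:
  assumes "0 < \<eta>"
  shows "u_collision \<eta> (circle_point \<eta> \<sigma> N E s) = circle_point \<eta> \<sigma> N E (- s - gam \<eta>)"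
proof -
  obtain S P Q where d: "S = sqrt \<eta>" "P = sqrt (1 + \<eta>)" "Q = sqrt (2 + \<eta>)"
    "0 < S" "0 < P" "0 < Q" "\<eta> = S\<^sup>2" "P\<^sup>2 = 1 + S\<^sup>2" "Q\<^sup>2 = 2 + S\<^sup>2"
    "frame1 \<eta> = (1 / (P * Q), - P / Q, S / (P * Q))" "frame2 \<eta> = (- S / P, 0, 1 / P)"
    by (rule sqrt_abbrevs[OF assms])
  define w where "w = arccos (1 / (1 + \<eta>))"
  have cw: "cos w = 1 / P\<^sup>2"
    unfolding w_def d(8) d(7)[symmetric] using assms by (intro cos_arccos) (auto simp: field_simps)
  have "sin w = sqrt (1 - (1 / (1 + \<eta>))\<^sup>2)"
    unfolding w_def using assms by (intro sin_arccos) (auto simp: field_simps)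
  also have "1 - (1 / (1 + \<eta>))\<^sup>2 = \<eta> * (2 + \<eta>) / (1 + \<eta>)\<^sup>2"
    using assms by (simp add: divide_simps) (simp add: algebra_simps power2_eq_square)
  finally have sw: "sin w = S * Q / P\<^sup>2"
    using assms by (simp add: real_sqrt_divide real_sqrt_mult d(1-3))
  have n: "(0, S, -1) = (- P) *\<^sub>R (sin w *\<^sub>R frame1 \<eta> + cos w *\<^sub>R frame2 \<eta>)"
  proof -
    have "P * (S * Q / P\<^sup>2 * (S / (P * Q)) + 1 / P\<^sup>2 * (1 / P)) = (S\<^sup>2 + 1) / P\<^sup>2"
      using d(5,6) by (simp add: field_simps power2_eq_square)
    then have "P * (S * Q / P\<^sup>2 * (S / (P * Q)) + 1 / P\<^sup>2 * (1 / P)) = 1"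
      using d(5) by (simp add: d(8)[symmetric] add.commute)
    then have z: "-1 = - P * (S * Q / P\<^sup>2 * (S / (P * Q)) + 1 / P\<^sup>2 * (1 / P))" by simp
    have x: "0 = - P * (S * Q / P\<^sup>2 * (1 / (P * Q)) + 1 / P\<^sup>2 * (- S / P))"
      and y: "S = - P * (S * Q / P\<^sup>2 * (- P / Q) + 1 / P\<^sup>2 * 0)"
      using d(5,6) by (simp_all add: field_simps power2_eq_square)
    show ?thesis
      unfolding cw sw d(10,11) scaleR_Pair add_Pair real_scaleR_def using x y z by blast
  qed
  have g: "2 * pi * (- s - gam \<eta>) = - (2 * pi * s) - 2 * w"
    by (simp add: gam_def w_def field_simps)
  show ?thesis
    unfolding u_collision_def circle_point_def d(1)[symmetric] n g
    using d(5) by (intro reflection_frame assms) simp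
qed

lemma circle_point_speed:
  assumes "0 < \<eta>" "N\<^sup>2 < E * (2 + \<eta>)" "\<sigma> \<in> {-1, 1}"
  shows "\<exists>D. (circle_point \<eta> \<sigma> N E has_vector_derivative D) (at s) \<and>
             norm D = 2 * pi * radius \<eta> N E"
proof -
  define x where "x = 2 * pi * s"
  define D where "D = (\<sigma> * radius \<eta> N E) *\<^sub>R
       ((- sin x * (2 * pi)) *\<^sub>R frame1 \<eta> + (cos x * (2 * pi)) *\<^sub>R frame2 \<eta>)"
  have der: "(circle_point \<eta> \<sigma> N E has_vector_derivative D) (at s)"
    unfolding circle_point_def D_def x_def
    by (auto intro!: derivative_eq_intros simp: has_real_derivative_iff_has_vector_derivative[symmetric])
  have "(c *\<^sub>R (a *\<^sub>R frame1 \<eta> + b *\<^sub>R frame2 \<eta>)) \<bullet> (c *\<^sub>R (a *\<^sub>R frame1 \<eta> + b *\<^sub>R frame2 \<eta>))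
      = c\<^sup>2 * (a\<^sup>2 + b\<^sup>2)" for a b c
    using frame_products[OF assms(1)]
    by (simp add: inner_add_left inner_add_right power2_eq_square algebra_simps)
  then have "D \<bullet> D = (\<sigma> * radius \<eta> N E)\<^sup>2 * ((- sin x * (2 * pi))\<^sup>2 + (cos x * (2 * pi))\<^sup>2)"
    unfolding D_def .
  also have "\<dots> = (\<sigma> * radius \<eta> N E)\<^sup>2 * ((2 * pi)\<^sup>2 * ((sin x)\<^sup>2 + (cos x)\<^sup>2))"
    by (simp only: power_mult_distrib power2_minus distrib_left mult.commute mult.left_commute)
  also have "\<dots> = (2 * pi * radius \<eta> N E)\<^sup>2"
    using assms(3) by (auto simp: power_mult_distrib)
  finally have "norm D = 2 * pi * radius \<eta> N E"
    using radius_pos[OF assms(1,2)] by (simp add: norm_eq_sqrt_inner)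
  with der show ?thesis by blast
qed

lemma circle_point_bij:
  assumes "0 < \<eta>" "N\<^sup>2 < E * (2 + \<eta>)" "\<sigma> \<in> {-1, 1}"
  shows "bij_betw (circle_point \<eta> \<sigma> N E) {0..<1} (velocity_circle \<eta> N E)"
proof -
  note o = frame_products[OF assms(1)]
  define r where "r = \<sigma> * radius \<eta> N E"
  define n :: velocity where "n = (1, 1, sqrt \<eta>)"
  have nn: "n \<bullet> n = 2 + \<eta>" using assms(1) by (simp add: n_def)
  have r: "r \<noteq> 0" "r\<^sup>2 = E - N\<^sup>2 / (2 + \<eta>)"
    using assms radius_pos[OF assms(1,2)]
    by (auto simp: r_def power_mult_distrib radius_def field_simps)
  have vc: "p \<in> velocity_circle \<eta> N E \<longleftrightarrow> p \<bullet> p = E \<and> p \<bullet> n = N" for p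
    by (cases p) (auto simp: velocity_circle_def n_def power2_eq_square algebra_simps)
  have c: "center \<eta> N = (N / (2 + \<eta>)) *\<^sub>R n" by (simp add: center_def n_def)
  have cc: "center \<eta> N \<bullet> center \<eta> N = N\<^sup>2 / (2 + \<eta>)" "center \<eta> N \<bullet> n = N"
    using assms(1) nn by (simp_all add: c power2_eq_square)
  have fn: "frame1 \<eta> \<bullet> n = 0" "frame2 \<eta> \<bullet> n = 0" using frame_orthonormal[OF assms(1)] by (simp_all only: n_def)
  have cp: "circle_point \<eta> \<sigma> N E s = center \<eta> N +
      r *\<^sub>R (cos (2 * pi * s) *\<^sub>R frame1 \<eta> + sin (2 * pi * s) *\<^sub>R frame2 \<eta>)" for s
    by (simp add: circle_point_def r_def)
  have co: "circle_point \<eta> \<sigma> N E s \<bullet> frame1 \<eta> = r * cos (2 * pi * s)"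
       "circle_point \<eta> \<sigma> N E s \<bullet> frame2 \<eta> = r * sin (2 * pi * s)" for s
    using o by (simp_all add: cp inner_add_left)
  have into: "circle_point \<eta> \<sigma> N E s \<in> velocity_circle \<eta> N E" for s
  proof -
    have "(center \<eta> N + r *\<^sub>R (a *\<^sub>R frame1 \<eta> + b *\<^sub>R frame2 \<eta>)) \<bullet>
        (center \<eta> N + r *\<^sub>R (a *\<^sub>R frame1 \<eta> + b *\<^sub>R frame2 \<eta>))
        = N\<^sup>2 / (2 + \<eta>) + r\<^sup>2 * (b\<^sup>2 + a\<^sup>2)" for a b
      using o cc by (simp add: inner_add_left inner_add_right power2_eq_square algebra_simps)
    then have "circle_point \<eta> \<sigma> N E s \<bullet> circle_point \<eta> \<sigma> N E s = E" by (simp add: cp r)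
    moreover have "circle_point \<eta> \<sigma> N E s \<bullet> n = N"
      using fn cc by (simp add: cp inner_add_left)
    ultimately show ?thesis by (simp add: vc)
  qed
  have inj: "inj_on (circle_point \<eta> \<sigma> N E) {0..<1}"
  proof (rule inj_onI)
    fix s t :: real
    assume st: "s \<in> {0..<1}" "t \<in> {0..<1}"
      and eq: "circle_point \<eta> \<sigma> N E s = circle_point \<eta> \<sigma> N E t"
    have "cos (2 * pi * s) = cos (2 * pi * t) \<and> sin (2 * pi * s) = sin (2 * pi * t)"
      using co[of s] co[of t] r eq by auto
    then obtain k :: int where k: "2 * pi * s = 2 * pi * t + 2 * pi * k"
      using sin_cos_eq_iff[of "2 * pi * s" "2 * pi * t"] by auto
    then have "s = t + k"
      by (simp flip: distrib_left)
    moreover from this st have "k = 0" by auto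
    ultimately show "s = t" by simp
  qed
  have onto: "\<exists>s \<in> {0..<1}. p = circle_point \<eta> \<sigma> N E s" if p: "p \<in> velocity_circle \<eta> N E" for p
  proof -
    obtain S P Q where d: "S = sqrt \<eta>" "P = sqrt (1 + \<eta>)" "Q = sqrt (2 + \<eta>)"
      "0 < S" "0 < P" "0 < Q" "\<eta> = S\<^sup>2" "P\<^sup>2 = 1 + S\<^sup>2" "Q\<^sup>2 = 2 + S\<^sup>2"
      "frame1 \<eta> = (1 / (P * Q), - P / Q, S / (P * Q))" "frame2 \<eta> = (- S / P, 0, 1 / P)"
      by (rule sqrt_abbrevs[OF assms(1)])
    define x y where xy: "x = p \<bullet> frame1 \<eta>" "y = p \<bullet> frame2 \<eta>"
    obtain v u q where pv: "p = (v, u, q)" by (cases p)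
    have N: "N = v + u + S * q" using p by (simp add: velocity_circle_def pv d(1))
    have PQ: "P * P = 1 + S * S" "Q * Q = 2 + S * S" using d(8,9) by (auto simp: power2_eq_square)
    have nz: "1 + S * S \<noteq> 0" "2 + S * S \<noteq> 0" by (smt (verit) zero_le_square)+
    have x: "x = (v - (P * P) * u + S * q) / (P * Q)" and y: "y = (q - S * v) / P"
      using d(5,6) by (simp_all add: xy pv d(10,11) field_simps)
    have dec: "p = center \<eta> N + (x *\<^sub>R frame1 \<eta> + y *\<^sub>R frame2 \<eta>)"
    proof -
      have 1: "x / (P * Q) = (v - (1 + S * S) * u + S * q) / ((1 + S * S) * (2 + S * S))"
        unfolding x PQ(1)[symmetric] PQ(2)[symmetric] by (simp add: ac_simps)
      have 2: "x * P / Q = (v - (1 + S * S) * u + S * q) / (2 + S * S)"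
        using d(5) unfolding x PQ(1)[symmetric] PQ(2)[symmetric] by (simp add: ac_simps)
      have 3: "y / P = (q - S * v) / (1 + S * S)"
        unfolding y PQ(1)[symmetric] by simp
      have "v = N / (2 + S * S) + (x / (P * Q) - S * (y / P))"
        unfolding 1 3 N using nz by (simp add: divide_simps) (simp add: algebra_simps)
      moreover have "u = N / (2 + S * S) - x * P / Q"
        unfolding 2 N using nz by (simp add: divide_simps) (simp add: algebra_simps)
      moreover have "q = N / (2 + S * S) * S + (S * (x / (P * Q)) + y / P)"
        unfolding 1 3 N using nz by (simp add: divide_simps) (simp add: algebra_simps)
      ultimately show ?thesis
        unfolding pv c n_def d(10,11) d(1)[symmetric] unfolding d(7)
        by (simp add: power2_eq_square mult.commute)
    qed
    have "p \<bullet> p = N\<^sup>2 / (2 + \<eta>) + (x\<^sup>2 + y\<^sup>2)"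
      using o cc by (subst (1 2) dec)
        (simp add: inner_add_left inner_add_right power2_eq_square algebra_simps)
    then have "x\<^sup>2 + y\<^sup>2 = r\<^sup>2" using p vc r by auto
    then have "(x / r)\<^sup>2 + (y / r)\<^sup>2 = 1"
      using r(1) by (simp add: power_divide flip: add_divide_distrib)
    then obtain a where a: "0 \<le> a" "a < 2 * pi" "x / r = cos a" "y / r = sin a"
      by (rule sincos_total_2pi)
    have "p = circle_point \<eta> \<sigma> N E (a / (2 * pi))"
      unfolding cp using a r(1) by (subst dec) (simp add: scaleR_add_right field_simps)
    moreover have "a / (2 * pi) \<in> {0..<1}" using a by simp
    ultimately show ?thesis by blast
  qed
  show ?thesis
    unfolding bij_betw_def using inj into onto by blast
qed

end

theory Submission
  imports Defs
begin

text \<open>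
  When the normal components are close to \<open>1\<close> and \<open>E\<close> is small, all three flight times are
  uniformly close to \<open>c = 2 (1 - R)\<close>.  For \<open>\<tau>\<^sub>1 = \<tau>\<^sub>2 = \<tau>\<^sub>3\<close> every \<open>(s, t)\<close> with
  \<open>0 < t < 1\<close> is odd and \<open>t\<close> is preserved, so for nearby flight times \<open>t\<close> drifts slowly and an
  orbit starting with \<open>t\<close> away from \<open>0\<close> and \<open>1\<close> remains odd for as many steps as desired.  The
  initial set can be the same for all \<open>\<epsilon>\<close>; only the parameter set has to shrink.
\<close>

text \<open>Brings arguments such as \<open>- s - gam \<eta>\<close> in \<open>tau3\<close> back to
  \<open>{0..<1}\<close>, the domain of \<open>circle_point_bij\<close>.\<close>

lemma circle_point_frac: "circle_point \<eta> \<sigma> N E (frac s) = circle_point \<eta> \<sigma> N E s"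
proof -
  have "2 * pi * s = 2 * pi * frac s + 2 * pi * of_int \<lfloor>s\<rfloor>"
    by (simp add: frac_def algebra_simps)
  then have "sin (2 * pi * s) = sin (2 * pi * frac s)" "cos (2 * pi * s) = cos (2 * pi * frac s)"
    using sin_cos_eq_iff by blast+
  then show ?thesis by (simp add: circle_point_def)
qed

text \<open>The velocity circle lies on the sphere of squared radius \<open>E\<close>. The bound is
  independent of \<open>s\<close>, so a small \<open>E\<close> controls all flight times at once,
  wherever the rotation carries \<open>s\<close>.\<close>

lemma tangential_components_le:
  assumes "0 < \<eta>" "N\<^sup>2 < E * (2 + \<eta>)" "\<sigma> \<in> {-1, 1}"
  shows "\<bar>v_at \<eta> \<sigma> (N, E, vn, un) s\<bar> \<le> sqrt E" "\<bar>u_at \<eta> \<sigma> (N, E, vn, un) s\<bar> \<le> sqrt E"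
proof -
  have "circle_point \<eta> \<sigma> N E (frac s) \<in> velocity_circle \<eta> N E"
    using circle_point_bij[OF assms] by (rule bij_betwE[rule_format]) (simp add: frac_lt_1)
  then obtain v u q where p: "circle_point \<eta> \<sigma> N E s = (v, u, q)" and E: "v\<^sup>2 + u\<^sup>2 + q\<^sup>2 = E"
    by (auto simp: circle_point_frac velocity_circle_def)
  have "v\<^sup>2 \<le> E" "u\<^sup>2 \<le> E" unfolding E[symmetric] by simp_all
  then have "\<bar>v\<bar> \<le> sqrt E" "\<bar>u\<bar> \<le> sqrt E" by (simp_all add: real_le_rsqrt)
  then show "\<bar>v_at \<eta> \<sigma> (N, E, vn, un) s\<bar> \<le> sqrt E" "\<bar>u_at \<eta> \<sigma> (N, E, vn, un) s\<bar> \<le> sqrt E"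
    by (simp_all add: p)
qed

lemma isCont_tau_0_1: "isCont (\<lambda>(a, b). tau R a b) (0, 1)"
  unfolding tau_def flight_length_def case_prod_unfold
  by (intro continuous_intros) auto

text \<open>Continuity at \<open>(0, 1)\<close>: radial motion at unit speed crosses the annulus of
  width \<open>1 - R\<close> twice, which gives the value \<open>2 * (1 - R)\<close>.\<close>

lemma tau_near:
  assumes "0 < \<delta>"
  obtains \<kappa> where "0 < \<kappa>" "\<kappa> \<le> 1"
    "\<And>a b. \<bar>a\<bar> < \<kappa> \<Longrightarrow> \<bar>b - 1\<bar> < \<kappa> \<Longrightarrow> \<bar>tau R a b - 2 * (1 - R)\<bar> \<le> \<delta>"
proof -
  from isCont_tau_0_1[of R, unfolded continuous_at_eps_delta] assms
  obtain d where d: "0 < d"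
    "\<And>x. dist x (0, 1) < d \<Longrightarrow> dist (case x of (a, b) \<Rightarrow> tau R a b) (tau R 0 1) < \<delta>"
    by fastforce
  have t0: "tau R 0 1 = 2 * (1 - R)" by (simp add: tau_def flight_length_def)
  show ?thesis
  proof (rule that[of "min 1 (d / 2)"])
    fix a b :: real
    assume ab: "\<bar>a\<bar> < min 1 (d / 2)" "\<bar>b - 1\<bar> < min 1 (d / 2)"
    have "dist (a, b) (0, 1) \<le> \<bar>a\<bar> + \<bar>b - 1\<bar>"
      using sqrt_sum_squares_le_sum_abs[of a "b - 1"] by (simp add: dist_Pair_Pair dist_real_def)
    then have "dist (a, b) (0, 1) < d" using ab by simp
    from d(2)[OF this] show "\<bar>tau R a b - 2 * (1 - R)\<bar> \<le> \<delta>"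
      by (simp add: t0 dist_real_def)
  qed (use d in auto)
qed

text \<open>If all flight times equalled \<open>c\<close>, then \<open>lam_hat\<close> and
  \<open>t_hat\<close> would be 1/2 and the sum deciding the case would be
  \<open>(t + 1) / 2\<close>, strictly between 1/2 and 1. Keeping \<open>t\<close> at distance 1/8
  from 0 and 1 leaves room for the relative error \<open>\<theta> / 8\<close> in the flight
  times.\<close>

lemma odd_step:
  assumes c: "0 < c" and \<theta>: "0 < \<theta>" "\<theta> \<le> 1/8"
    and near: "\<bar>tau1 R \<eta> \<sigma> p s - c\<bar> \<le> \<theta> * c / 8" "\<bar>tau2 R \<eta> \<sigma> p s - c\<bar> \<le> \<theta> * c / 8"
      "\<bar>tau3 R \<eta> \<sigma> p s - c\<bar> \<le> \<theta> * c / 8"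
    and s: "0 \<le> s" "s < 1" and t: "1/8 \<le> t" "t \<le> 7/8"
  shows "(s, t) \<in> odd_part R \<eta> \<sigma> p"
    and "fst (evolution R \<eta> \<sigma> p (s, t)) = frac (s + gam \<eta>)"
    and "\<bar>snd (evolution R \<eta> \<sigma> p (s, t)) - t\<bar> < \<theta>"
proof -
  define x y z where xyz: "x = tau1 R \<eta> \<sigma> p s" "y = tau2 R \<eta> \<sigma> p s" "z = tau3 R \<eta> \<sigma> p s"
  have \<theta>c: "\<theta> * c \<le> c / 8" "0 < \<theta> * c" using mult_right_mono[OF \<theta>(2), of c] c \<theta> by simp_all
  have b: "\<bar>x - c\<bar> \<le> \<theta> * c / 8" "\<bar>y - c\<bar> \<le> \<theta> * c / 8" "\<bar>z - c\<bar> \<le> \<theta> * c / 8"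
    using near by (simp_all add: xyz)
  have b': "63 / 64 * c \<le> x" "x \<le> 65 / 64 * c" "63 / 64 * c \<le> y" "y \<le> 65 / 64 * c"
    "63 / 64 * c \<le> z" "z \<le> 65 / 64 * c"
    using b \<theta>c by linarith+
  have pos: "0 < x" "0 < y" "0 < z" using b' c by linarith+
  have ty: "1/8 * y \<le> t * y" "t * y \<le> 7/8 * y" using t pos by (simp_all add: mult_right_mono)
  have lam: "lam_hat R \<eta> \<sigma> p s = y / (y + z)" by (simp add: lam_hat_def xyz)
  have "x < y + z" using b' c by linarith
  then have th: "t_hat R \<eta> \<sigma> p s = x / (y + z)"
    using pos by (simp add: t_hat_def frac_eq flip: xyz)
  have sum: "t * lam_hat R \<eta> \<sigma> p s + t_hat R \<eta> \<sigma> p s = (t * y + x) / (y + z)"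
    by (simp add: lam th add_divide_distrib)
  \<comment> \<open>Each inequality has slack at least \<open>y / 8\<close>, while any two of
    \<open>x\<close>, \<open>y\<close>, \<open>z\<close> differ by at most
    \<open>c / 32\<close>.\<close>
  have "t * y + x < y + z" "y < t * y + x" using ty b' c by linarith+
  then have fr: "frac ((t * y + x) / (y + z)) = (t * y + x) / (y + z)" and
    gt: "y / (y + z) < (t * y + x) / (y + z)"
    using pos ty by (simp_all add: frac_eq divide_strict_right_mono)
  show odd: "(s, t) \<in> odd_part R \<eta> \<sigma> p"
    using s t gt unfolding odd_part_def phase_space_def by (simp add: sum fr) (simp add: lam)
  then have not_even: "(s, t) \<notin> even_part R \<eta> \<sigma> p"
    by (auto simp: odd_part_def even_part_def)
  have "1 - y / (y + z) = z / (y + z)" using pos by (simp add: field_simps)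
  then have q: "x / (y + z) / (1 - y / (y + z)) = x / z" using pos by simp
  have ev: "evolution R \<eta> \<sigma> p (s, t) = (frac (s + gam \<eta>), frac (y / z * t + x / z))"
    using odd not_even by (simp only: evolution_def case_prod_conv if_True if_False lam th q flip: xyz)
  \<comment> \<open>The displacement of \<open>t\<close>. As \<open>x / z\<close> is near 1, the new
    phase is \<open>t + r\<close> plus one full turn, which \<open>frac\<close> removes.\<close>
  define r where "r = (t * (y - z) + (x - z)) / z"
  have e: "y / z * t + x / z = t + r + 1" using pos by (simp add: r_def field_simps)
  have r: "\<bar>r\<bar> < \<theta>"
  proof -
    have "\<bar>t * (y - z) + (x - z)\<bar> \<le> \<bar>t * (y - z)\<bar> + \<bar>x - z\<bar>" by (rule abs_triangle_ineq)
    also have "\<bar>t * (y - z)\<bar> \<le> 1 * \<bar>y - z\<bar>" unfolding abs_mult using t by (intro mult_right_mono) auto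
    also have "1 * \<bar>y - z\<bar> + \<bar>x - z\<bar> \<le> \<theta> * c / 2"
      using abs_triangle_ineq4[of "y - c" "z - c"] abs_triangle_ineq4[of "x - c" "z - c"] b by simp
    also have "\<dots> < \<theta> * z" using b' c \<theta> by simp
    finally show ?thesis using pos by (simp add: r_def abs_divide pos_divide_less_eq)
  qed
  have "0 \<le> t + r" "t + r < 1" using r t \<theta>(2) by linarith+
  then have "frac (y / z * t + x / z) = t + r"
    by (simp only: e frac_1_eq frac_eq)
  then show "fst (evolution R \<eta> \<sigma> p (s, t)) = frac (s + gam \<eta>)"
    and "\<bar>snd (evolution R \<eta> \<sigma> p (s, t)) - t\<bar> < \<theta>"
    using ev r by simp_all
qed

text \<open>Fewer than \<open>n\<close> steps with drift below \<open>1 / (8 * n)\<close> each move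
  \<open>t\<close> by at most 1/8 in total, so starting in \<open>[1/4, 3/4]\<close> it never leaves
  the range \<open>[1/8, 7/8]\<close> required by \<open>odd_step\<close>.\<close>

lemma odd_orbit:
  fixes n :: nat
  assumes c: "0 < c" and n: "0 < n"
    and near: "\<And>s. \<bar>tau1 R \<eta> \<sigma> p s - c\<bar> \<le> c / (64 * n)" "\<And>s. \<bar>tau2 R \<eta> \<sigma> p s - c\<bar> \<le> c / (64 * n)"
      "\<And>s. \<bar>tau3 R \<eta> \<sigma> p s - c\<bar> \<le> c / (64 * n)"
    and s0: "0 \<le> s0" "s0 < 1" and t0: "1/4 \<le> t0" "t0 \<le> 3/4" and "k < n"
  shows "(evolution R \<eta> \<sigma> p ^^ k) (s0, t0) \<in> odd_part R \<eta> \<sigma> p"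
    and "fst ((evolution R \<eta> \<sigma> p ^^ k) (s0, t0)) = frac (s0 + real k * gam \<eta>)"
proof -
  define \<theta> where "\<theta> = 1 / (8 * real n)"
  have \<theta>: "0 < \<theta>" "\<theta> \<le> 1/8" "c / (64 * n) = \<theta> * c / 8" "real n * \<theta> = 1/8"
    using n by (simp_all add: \<theta>_def)
  note step = odd_step[OF c \<theta>(1,2) near[unfolded \<theta>(3)]]
  define z where "z k = (evolution R \<eta> \<sigma> p ^^ k) (s0, t0)" for k
  \<comment> \<open>The drift bound is carried along because it provides the hypothesis on
    \<open>t\<close> for the next step.\<close>
  have inv: "fst (z k) = frac (s0 + real k * gam \<eta>) \<and> \<bar>snd (z k) - t0\<bar> \<le> real k * \<theta>
      \<and> z k \<in> odd_part R \<eta> \<sigma> p" if "k < n" for k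
    using that
  proof (induction k)
    case 0
    then show ?case using s0 t0 step(1)[of s0 t0] by (simp add: z_def frac_eq)
  next
    case (Suc k)
    then have IH: "fst (z k) = frac (s0 + real k * gam \<eta>)" "\<bar>snd (z k) - t0\<bar> \<le> real k * \<theta>" by auto
    have k: "real (Suc k) * \<theta> \<le> 1/8"
      using Suc.prems \<theta>(1) mult_right_mono[of "real (Suc k)" "real n" \<theta>] unfolding \<theta>(4) by simp
    then have "real k * \<theta> \<le> 1/8" using \<theta>(1) by (simp add: algebra_simps)
    then have "1/8 \<le> snd (z k)" "snd (z k) \<le> 7/8" using IH(2) t0 by linarith+
    moreover have "0 \<le> fst (z k)" "fst (z k) < 1" by (simp_all add: IH(1) frac_lt_1)
    moreover have "z (Suc k) = evolution R \<eta> \<sigma> p (fst (z k), snd (z k))" by (simp add: z_def)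
    ultimately have z: "fst (z (Suc k)) = frac (fst (z k) + gam \<eta>)"
      "\<bar>snd (z (Suc k)) - snd (z k)\<bar> < \<theta>"
      using step(2,3)[of "fst (z k)" "snd (z k)"] by simp_all
    have f: "fst (z (Suc k)) = frac (s0 + real (Suc k) * gam \<eta>)"
      unfolding z(1) IH(1) by (simp add: frac_def algebra_simps)
    moreover have d: "\<bar>snd (z (Suc k)) - t0\<bar> \<le> real (Suc k) * \<theta>"
      using z(2) IH(2) by (simp add: algebra_simps)
    moreover have "1/8 \<le> snd (z (Suc k))" "snd (z (Suc k)) \<le> 7/8" using d k t0 by linarith+
    then have "z (Suc k) \<in> odd_part R \<eta> \<sigma> p"
      using step(1)[of "fst (z (Suc k))" "snd (z (Suc k))"]
      unfolding prod.collapse by (simp add: f frac_lt_1)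
    ultimately show ?case by blast
  qed
  from inv[OF \<open>k < n\<close>]
  show "(evolution R \<eta> \<sigma> p ^^ k) (s0, t0) \<in> odd_part R \<eta> \<sigma> p"
    and "fst ((evolution R \<eta> \<sigma> p ^^ k) (s0, t0)) = frac (s0 + real k * gam \<eta>)"
    by (simp_all add: z_def)
qed

lemma ex_open_parameters_tau_near:
  assumes "0 < \<eta>" "\<sigma> \<in> {-1, 1}" "0 < \<delta>"
  obtains W where "open W" "W \<noteq> {}" "W \<subseteq> parameters \<eta>"
    "\<And>p s. p \<in> W \<Longrightarrow> \<bar>tau1 R \<eta> \<sigma> p s - 2 * (1 - R)\<bar> \<le> \<delta>"
    "\<And>p s. p \<in> W \<Longrightarrow> \<bar>tau2 R \<eta> \<sigma> p s - 2 * (1 - R)\<bar> \<le> \<delta>"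
    "\<And>p s. p \<in> W \<Longrightarrow> \<bar>tau3 R \<eta> \<sigma> p s - 2 * (1 - R)\<bar> \<le> \<delta>"
proof -
  obtain \<kappa> where \<kappa>: "0 < \<kappa>" "\<kappa> \<le> 1"
    "\<And>a b. \<bar>a\<bar> < \<kappa> \<Longrightarrow> \<bar>b - 1\<bar> < \<kappa> \<Longrightarrow> \<bar>tau R a b - 2 * (1 - R)\<bar> \<le> \<delta>"
    using tau_near[OF \<open>0 < \<delta>\<close>, of R] by blast
  \<comment> \<open>Strict inequalities between continuous functions make \<open>W\<close> open;
    \<open>E < \<kappa>\<^sup>2\<close> puts the tangential components below
    \<open>\<kappa>\<close>.\<close>
  define W :: "integrals set" where
    "W = {(N, E, vn, un). N\<^sup>2 < E * (2 + \<eta>) \<and> E < \<kappa>\<^sup>2 \<and> \<bar>vn - 1\<bar> < \<kappa> \<and> \<bar>un - 1\<bar> < \<kappa>}"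
  show ?thesis
  proof (rule that[of W])
    show "open W"
      unfolding W_def case_prod_unfold
      by (intro open_Collect_conj open_Collect_less continuous_intros)
    have "(0, \<kappa>\<^sup>2 / 2, 1, 1) \<in> W" using \<kappa> assms by (simp add: W_def)
    then show "W \<noteq> {}" by blast
    \<comment> \<open>\<open>\<kappa> \<le> 1\<close> forces \<open>vn\<close> and \<open>un\<close>
      to be positive.\<close>
    show "W \<subseteq> parameters \<eta>" using \<kappa>(2) by (auto simp: W_def parameters_def)
    fix p s assume "p \<in> W"
    then obtain N E vn un where p: "p = (N, E, vn, un)" and
      W: "N\<^sup>2 < E * (2 + \<eta>)" "E < \<kappa>\<^sup>2" "\<bar>vn - 1\<bar> < \<kappa>" "\<bar>un - 1\<bar> < \<kappa>"
      by (auto simp: W_def)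
    have "sqrt E < \<kappa>" using W(2) \<kappa>(1) by (simp add: real_less_lsqrt)
    note small = tangential_components_le[OF assms(1) W(1) assms(2), THEN le_less_trans, OF this]
    show "\<bar>tau1 R \<eta> \<sigma> p s - 2 * (1 - R)\<bar> \<le> \<delta>" "\<bar>tau2 R \<eta> \<sigma> p s - 2 * (1 - R)\<bar> \<le> \<delta>"
      "\<bar>tau3 R \<eta> \<sigma> p s - 2 * (1 - R)\<bar> \<le> \<delta>"
      unfolding p tau1.simps tau2.simps tau3.simps by (intro \<kappa>(3) small W(3,4))+
  qed
qed

theorem theorem4p4:
  fixes R \<eta> \<sigma> :: real
  assumes "0 < R" "R < 1" "0 < \<eta>" "\<sigma> \<in> {-1, 1}"
  shows "\<exists>(Ne :: real \<Rightarrow> nat) \<epsilon>0. 0 < \<epsilon>0 \<and>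
    (\<forall>\<epsilon>. 0 < \<epsilon> \<and> \<epsilon> < \<epsilon>0 \<longrightarrow> 0 < Ne \<epsilon> \<and>
      (\<exists>(W :: integrals set) (A :: (real \<times> real) set).
         open W \<and> W \<noteq> {} \<and> W \<subseteq> parameters \<eta> \<and>
         A \<subseteq> phase_space \<and> A \<in> sets lebesgue \<and> \<epsilon> < measure lebesgue A \<and>
         (\<forall>p \<in> W. \<forall>(s0, t0) \<in> A. \<forall>k < Ne \<epsilon>.
            (evolution R \<eta> \<sigma> p ^^ k) (s0, t0) \<in> odd_part R \<eta> \<sigma> p \<and>
            fst ((evolution R \<eta> \<sigma> p ^^ k) (s0, t0)) = frac (s0 + real k * gam \<eta>)))) \<and>
    filterlim Ne at_top (at_right 0)"
\<comment> \<open>Any positive integer function tending to infinity at 0 would serve, since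
  \<open>W\<close> is chosen after the number of steps. The threshold 1/4 is the area of
  \<open>A\<close>.\<close>
proof (rule exI[of _ "\<lambda>\<epsilon>. nat \<lfloor>1 / \<epsilon>\<rfloor>"], rule exI[of _ "1/4"], intro conjI allI impI)
  fix \<epsilon> :: real assume \<epsilon>: "0 < \<epsilon> \<and> \<epsilon> < 1/4"
  define n where "n = nat \<lfloor>1 / \<epsilon>\<rfloor>"
  define c where "c = 2 * (1 - R)"
  show n: "0 < nat \<lfloor>1 / \<epsilon>\<rfloor>" using \<epsilon> by simp
  have c: "0 < c" using assms by (simp add: c_def)
  have "0 < c / (64 * n)" using c n by (simp add: n_def)
  then obtain W where W: "open W" "W \<noteq> {}" "W \<subseteq> parameters \<eta>"
    "\<And>p s. p \<in> W \<Longrightarrow> \<bar>tau1 R \<eta> \<sigma> p s - c\<bar> \<le> c / (64 * n)"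
    "\<And>p s. p \<in> W \<Longrightarrow> \<bar>tau2 R \<eta> \<sigma> p s - c\<bar> \<le> c / (64 * n)"
    "\<And>p s. p \<in> W \<Longrightarrow> \<bar>tau3 R \<eta> \<sigma> p s - c\<bar> \<le> c / (64 * n)"
    using ex_open_parameters_tau_near[OF assms(3,4), where R = R] unfolding c_def by metis
  \<comment> \<open>The \<open>t\<close>-range is the one from \<open>odd_orbit\<close>. The
    \<open>s\<close>-range is arbitrary: a closed interval inside \<open>[0, 1)\<close> makes
    \<open>A\<close> a box of area 1/4.\<close>
  define A :: "(real \<times> real) set" where "A = cbox (0, 1/4) (1/2, 3/4)"
  have A: "A = {0..1/2} \<times> {1/4..3/4}" by (simp add: A_def cbox_Pair_eq)
  have "measure lebesgue A = 1/4"
    unfolding A_def by (simp add: content_Pair)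
  moreover have "A \<in> sets lebesgue" unfolding A_def by simp
  moreover have "A \<subseteq> phase_space" by (auto simp: A phase_space_def)
  ultimately have "A \<subseteq> phase_space \<and> A \<in> sets lebesgue \<and> \<epsilon> < measure lebesgue A"
    using \<epsilon> by simp
  moreover have "(evolution R \<eta> \<sigma> p ^^ k) (s0, t0) \<in> odd_part R \<eta> \<sigma> p \<and>
      fst ((evolution R \<eta> \<sigma> p ^^ k) (s0, t0)) = frac (s0 + real k * gam \<eta>)"
    if "p \<in> W" "(s0, t0) \<in> A" "k < n" for p s0 t0 k
    using odd_orbit[OF c _ W(4-6)[OF that(1)], of s0 t0 k] that n by (auto simp: A n_def)
  ultimately show "\<exists>W A. open W \<and> W \<noteq> {} \<and> W \<subseteq> parameters \<eta> \<and>
         A \<subseteq> phase_space \<and> A \<in> sets lebesgue \<and> \<epsilon> < measure lebesgue A \<and>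
         (\<forall>p \<in> W. \<forall>(s0, t0) \<in> A. \<forall>k < nat \<lfloor>1 / \<epsilon>\<rfloor>.
            (evolution R \<eta> \<sigma> p ^^ k) (s0, t0) \<in> odd_part R \<eta> \<sigma> p \<and>
            fst ((evolution R \<eta> \<sigma> p ^^ k) (s0, t0)) = frac (s0 + real k * gam \<eta>))"
    using W(1-3) unfolding n_def[symmetric] by (intro exI[of _ W] exI[of _ A]) auto
next
  have "filterlim (\<lambda>\<epsilon>::real. 1 / \<epsilon>) at_top (at_right 0)"
    using filterlim_inverse_at_top_right by (simp add: inverse_eq_divide)
  then show "filterlim (\<lambda>\<epsilon>::real. nat \<lfloor>1 / \<epsilon>\<rfloor>) at_top (at_right 0)"
    by (intro filterlim_compose[OF filterlim_nat_sequentially]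
        filterlim_compose[OF filterlim_floor_sequentially])
qed simp

end
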